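(* Let $\mathbf{n}=(n_1,n_2)$ be a pair of positive integers and let $I$ be an $\mathbf{n}$-quasi homogeneous ideal in $\mathbb{C}[x,y]$. Then for every real $t\ge -2$, $I$ has the stable division property with respect to the norm of $\mathcal{H}_2^{(t)}$. Moreover, if $\{f_1,\ldots,f_k\}$ is a Groebner basis for $I$ (with respect to the monomial order determined by $\mathbf{n}$) consisting of $\mathbf{n}$-quasi homogeneous polynomials all of the same $\mathbf{n}$-degree, then $\{f_1,\ldots,f_k\}$ is a stable generating set for $I$ with respect to the norm of $\mathcal{H}_2^{(t)}$, for every $t\geq -2$.
   Context: For real $t\ge -2$, $\mathcal{H}_2^{(t)}$ is the completion of $\mathbb{C}[x,y]$ with respect to the inner product making all monomials orthogonal with $\|x^{a}y^{b}\|_t^2=a!\,b!/\prod_{i=1}^{a+b}(2+t+i)$. It is the reproducing kernel Hilbert space on the unit ball of $\mathbb{C}^2$ with kernel $(1-\langle z,w\rangle)^{-(t+3)}$. A polynomial $h\in\mathbb{C}[x,y]$ is $\mathbf{n}$-quasi homogeneous of degree $m$, written $\deg_{\mathbf{n}}(h)=m$, if every monomial $x^ay^b$ appearing in $h$ satisfies $n_1a+n_2b=m$. An ideal is $\mathbf{n}$-quasi homogeneous if it is generated by $\mathbf{n}$-quasi homogeneous polynomials. Monomial order determined by $\mathbf{n}$: for nonzero scalars $\lambda,\mu$, $\lambda x^ky^l<\mu x^{m}y^{n}$ iff $kn_1+ln_2<mn_1+nn_2$, or $kn_1+ln_2=mn_1+nn_2$ and $k<m$. Groebner bases are taken with respect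 to this order. An ideal $I$ has the stable division property with respect to a norm $\|\cdot\|$ on $\mathbb{C}[x,y]$ if there are $f_1,\ldots,f_k\in I$ and a constant $A$ such that every $h\in I$ can be written as $h=\sum_{i=1}^k g_if_i$ with $g_1,\ldots,g_k\in\mathbb{C}[x,y]$ and $\sum_{i=1}^k\|g_if_i\|\le A\|h\|$. Such a set $\{f_1,\ldots,f_k\}$ is called a stable generating set. *)

theory Defs
  imports Complex_Main "HOL-Library.Poly_Mapping" "HOL-Library.Product_Plus"
begin

(* The polynomial ring C[x,y]: finitely supported functions from exponent pairs (a,b),
   standing for x^a y^b, to coefficients; multiplication on this type is convolution. *)
type_synonym bipoly = "(nat \<times> nat) \<Rightarrow>\<^sub>0 complex"

(* The ring as a module over itself: its submodules are the ideals, and the span of a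
   set is the ideal generated by it. *)
lemma module_times: "module ((*) :: bipoly \<Rightarrow> bipoly \<Rightarrow> bipoly)"
  by unfold_locales (simp_all add: algebra_simps)

definition ideal_generated_by :: "bipoly set \<Rightarrow> bipoly set" where
  "ideal_generated_by S = module.span (*) S"

definition H2_weight :: "real \<Rightarrow> nat \<times> nat \<Rightarrow> real" where
  "H2_weight t = (\<lambda>(a, b). fact a * fact b / (\<Prod>i=1..a + b. 2 + t + real i))"

definition H2_inner :: "real \<Rightarrow> bipoly \<Rightarrow> bipoly \<Rightarrow> complex" where
  "H2_inner t f g =
     (\<Sum>p\<in>Poly_Mapping.keys f \<union> Poly_Mapping.keys g.
        Poly_Mapping.lookup f p * cnj (Poly_Mapping.lookup g p) * of_real (H2_weight t p))"

(* The norm of the completion, restricted to polynomials; meaningful for t >= -2, where all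
   the weights are positive. *)
definition H2_norm :: "real \<Rightarrow> bipoly \<Rightarrow> real" where
  "H2_norm t f = sqrt (Re (H2_inner t f f))"

lemma H2_inner_monomials:
  "H2_inner t (Poly_Mapping.single p 1) (Poly_Mapping.single q 1) =
     (if p = q then of_real (H2_weight t p) else 0)"
  by (simp add: H2_inner_def lookup_single when_def)

lemma H2_norm_monomial:
  assumes "t \<ge> -2"
  shows "(H2_norm t (Poly_Mapping.single (a, b) 1))\<^sup>2 =
    fact a * fact b / (\<Prod>i=1..a + b. 2 + t + real i)"
proof -
  have "(\<Prod>i=1..a + b. 2 + t + real i) \<ge> 0"
    using assms by (intro prod_nonneg) auto
  then have "H2_weight t (a, b) \<ge> 0"
    unfolding H2_weight_def by (simp only: case_prod_conv) simp
  moreover have "H2_norm t (Poly_Mapping.single (a, b) 1) = sqrt (H2_weight t (a, b))"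
    by (simp only: H2_norm_def H2_inner_monomials if_True Re_complex_of_real simp_thms)
  ultimately have "(H2_norm t (Poly_Mapping.single (a, b) 1))\<^sup>2 = H2_weight t (a, b)"
    by simp
  then show ?thesis
    by (simp only: H2_weight_def case_prod_conv)
qed

definition wdeg :: "nat \<times> nat \<Rightarrow> nat \<times> nat \<Rightarrow> nat" where
  "wdeg n p = fst n * fst p + snd n * snd p"

(* The zero polynomial is quasi homogeneous of every degree. *)
definition quasi_homogeneous :: "nat \<times> nat \<Rightarrow> nat \<Rightarrow> bipoly \<Rightarrow> bool" where
  "quasi_homogeneous n m h \<longleftrightarrow> (\<forall>p\<in>Poly_Mapping.keys h. wdeg n p = m)"

definition quasi_homogeneous_ideal :: "nat \<times> nat \<Rightarrow> bipoly set \<Rightarrow> bool" where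
  "quasi_homogeneous_ideal n I \<longleftrightarrow>
     (\<exists>S. (\<forall>h\<in>S. \<exists>m. quasi_homogeneous n m h) \<and> I = ideal_generated_by S)"

definition mon_less :: "nat \<times> nat \<Rightarrow> nat \<times> nat \<Rightarrow> nat \<times> nat \<Rightarrow> bool" where
  "mon_less n p q \<longleftrightarrow> wdeg n p < wdeg n q \<or> (wdeg n p = wdeg n q \<and> fst p < fst q)"

(* Used only for nonzero f and for n with positive entries, where the order on exponents is
   total, so that the largest exponent of f exists and is unique. *)
definition lead_exp :: "nat \<times> nat \<Rightarrow> bipoly \<Rightarrow> nat \<times> nat" where
  "lead_exp n f =
     (THE p. p \<in> Poly_Mapping.keys f \<and> (\<forall>q\<in>Poly_Mapping.keys f. q \<noteq> p \<longrightarrow> mon_less n q p))"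

lemma lead_exp_is_greatest:
  assumes "snd n > 0" "f \<noteq> 0"
  shows "lead_exp n f \<in> Poly_Mapping.keys f"
    and "\<And>q. q \<in> Poly_Mapping.keys f \<Longrightarrow> q \<noteq> lead_exp n f \<Longrightarrow> mon_less n q (lead_exp n f)"
proof -
  let ?K = "Poly_Mapping.keys f"
  have total: "mon_less n p q \<or> mon_less n q p" if "p \<noteq> q" for p q
  proof (cases "fst p = fst q")
    case True
    with that assms(1) have "wdeg n p \<noteq> wdeg n q"
      by (auto simp: wdeg_def prod_eq_iff)
    then show ?thesis by (auto simp: mon_less_def)
  qed (auto simp: mon_less_def)
  have trans: "mon_less n p r" if "mon_less n p q" "mon_less n q r" for p q r
    using that by (auto simp: mon_less_def)
  have asym: "\<not> mon_less n q p" if "mon_less n p q" for p q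
    using that by (auto simp: mon_less_def)
  have "\<exists>p\<in>A. \<forall>q\<in>A. q \<noteq> p \<longrightarrow> mon_less n q p" if "finite A" "A \<noteq> {}" for A
    using that
  proof (induction A rule: finite_ne_induct)
    case (insert x A)
    then obtain p where p: "p \<in> A" "\<forall>q\<in>A. q \<noteq> p \<longrightarrow> mon_less n q p" by blast
    then show ?case
    proof (cases "mon_less n x p")
      case True
      with p show ?thesis by blast
    next
      case False
      have "x \<noteq> p" using p(1) insert.hyps(3) by blast
      with False total[of x p] have "mon_less n p x" by blast
      then have "mon_less n q x" if "q \<in> A" for q
        using that p(2) trans[of q p x] \<open>mon_less n p x\<close> by (cases "q = p") auto
      then show ?thesis by blast
    qed
  qed simp
  moreover have "?K \<noteq> {}" using assms(2) by simp
  ultimately have "\<exists>p\<in>?K. \<forall>q\<in>?K. q \<noteq> p \<longrightarrow> mon_less n q p"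
    using finite_keys[of f] by simp
  then obtain p where p: "p \<in> ?K" "\<forall>q\<in>?K. q \<noteq> p \<longrightarrow> mon_less n q p" ..
  have "\<exists>!p. p \<in> ?K \<and> (\<forall>q\<in>?K. q \<noteq> p \<longrightarrow> mon_less n q p)"
  proof (rule ex1I[of _ p])
    show "p \<in> ?K \<and> (\<forall>q\<in>?K. q \<noteq> p \<longrightarrow> mon_less n q p)" using p by simp
    show "r = p" if r: "r \<in> ?K \<and> (\<forall>q\<in>?K. q \<noteq> r \<longrightarrow> mon_less n q r)" for r
    proof (rule ccontr)
      assume "r \<noteq> p"
      with p r have "mon_less n r p" "mon_less n p r" by auto
      then show False using asym by simp
    qed
  qed
  note greatest = theI'[OF this, folded lead_exp_def]
  show "lead_exp n f \<in> ?K"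
    and "\<And>q. q \<in> ?K \<Longrightarrow> q \<noteq> lead_exp n f \<Longrightarrow> mon_less n q (lead_exp n f)"
    using greatest by simp_all
qed

definition lead_term :: "nat \<times> nat \<Rightarrow> bipoly \<Rightarrow> bipoly" where
  "lead_term n f =
     Poly_Mapping.single (lead_exp n f) (Poly_Mapping.lookup f (lead_exp n f))"

definition groebner_basis :: "nat \<times> nat \<Rightarrow> bipoly set \<Rightarrow> bipoly set \<Rightarrow> bool" where
  "groebner_basis n I F \<longleftrightarrow> finite F \<and> F \<subseteq> I \<and>
     ideal_generated_by (lead_term n ` (F - {0})) = ideal_generated_by (lead_term n ` (I - {0}))"

definition stable_generating_set ::
    "(bipoly \<Rightarrow> real) \<Rightarrow> bipoly set \<Rightarrow> bipoly set \<Rightarrow> bool" where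
  "stable_generating_set N I F \<longleftrightarrow> finite F \<and> F \<subseteq> I \<and>
     (\<exists>A::real. \<forall>h\<in>I. \<exists>g :: bipoly \<Rightarrow> bipoly.
        h = (\<Sum>f\<in>F. g f * f) \<and> (\<Sum>f\<in>F. N (g f * f)) \<le> A * N h)"

definition stable_division_property :: "(bipoly \<Rightarrow> real) \<Rightarrow> bipoly set \<Rightarrow> bool" where
  "stable_division_property N I \<longleftrightarrow> (\<exists>F. stable_generating_set N I F)"

end

(* Work in a fixed quasi degree, where the monomials are linearly ordered by their second
   exponent, and let q bound the second exponents of the leading monomials of the basis. A step
   of the division algorithm at a leading monomial with second exponent below q costs a factor
   that is bounded independently of the degree, and it raises that second exponent, so at most q
   such steps occur. The remainder has all second exponents at least q; there divisibility by
   leading monomials depends on the first exponent only, so the division can be continued with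
   the single basis element f0 of least leading first exponent. It ends with the remainder g f0,
   for which there is nothing left to estimate. Distinct quasi degrees are orthogonal, which
   assembles the general case. *)

theory Submission
  imports Defs "HOL-Analysis.L2_Norm"
begin

subsection \<open>The weighted norm\<close>

lemma H2_weight_pos:
  assumes "t \<ge> -2"
  shows "H2_weight t p > 0"
proof -
  have "(\<Prod>i=1..a + b. 2 + t + real i) > 0" for a b :: nat
    using assms by (intro prod_pos) auto
  then show ?thesis
    by (cases p) (simp add: H2_weight_def)
qed

lemma H2_weight_Suc_snd_le:
  assumes "t \<ge> -2"
  shows "H2_weight t (a, Suc b) \<le> H2_weight t (a, b)"
proof -
  have "H2_weight t (a, Suc b) = H2_weight t (a, b) * ((1 + real b) / (3 + t + real a + real b))"
    by (simp add: H2_weight_def algebra_simps)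
  also have "\<dots> \<le> H2_weight t (a, b) * 1"
    using assms H2_weight_pos[OF assms, of "(a, b)"] by (intro mult_left_mono) (auto simp: field_simps)
  finally show ?thesis by simp
qed

text \<open>The ratio of the two weights is \<open>(3 + t + a + b) / (1 + a)\<close>. Since
  \<open>2 + t + b >= 0\<close>, it is at most its value at \<open>a = 0\<close>, so the bound does
  not grow with the first exponent.\<close>

lemma H2_weight_le_Suc_fst:
  assumes "t \<ge> -2"
  shows "H2_weight t (a, b) \<le> (3 + t + real b) * H2_weight t (Suc a, b)"
proof -
  have W: "H2_weight t (Suc a, b) = H2_weight t (a, b) * ((1 + real a) / (3 + t + real a + real b))"
    by (simp add: H2_weight_def algebra_simps)
  have "0 \<le> real a * (2 + t + real b)"
    using assms by (intro mult_nonneg_nonneg) auto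
  then have "1 \<le> (3 + t + real b) * ((1 + real a) / (3 + t + real a + real b))"
    using assms by (simp add: field_simps)
  then have "H2_weight t (a, b) * 1 \<le>
      H2_weight t (a, b) * ((3 + t + real b) * ((1 + real a) / (3 + t + real a + real b)))"
    using H2_weight_pos[OF assms, of "(a, b)"] by (intro mult_left_mono) auto
  then show ?thesis
    unfolding W by (simp add: mult_ac)
qed

text \<open>Descend from \<open>b'\<close> to \<open>b\<close> in column \<open>a'\<close>, where
  the weight can only grow, then move along row \<open>b\<close> from \<open>a'\<close> to
  \<open>a\<close>. The factor thus depends on the smaller second exponent and on the difference
  \<open>a - a'\<close> alone.\<close>

lemma H2_weight_le:
  assumes t: "t \<ge> -2" and "a' \<le> a" and "b \<le> b'"
  shows "H2_weight t (a', b') \<le> (3 + t + real b) ^ (a - a') * H2_weight t (a, b)"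
proof -
  have "H2_weight t (a', b') \<le> H2_weight t (a', b)"
    using \<open>b \<le> b'\<close>
  proof (induction b' rule: dec_induct)
    case (step m)
    then show ?case using H2_weight_Suc_snd_le[OF t, of a' m] by linarith
  qed simp
  also have "\<dots> \<le> (3 + t + real b) ^ (a - a') * H2_weight t (a, b)"
    using \<open>a' \<le> a\<close>
  proof (induction a rule: dec_induct)
    case (step m)
    have "(3 + t + real b) ^ (m - a') * H2_weight t (m, b) \<le>
        (3 + t + real b) ^ (m - a') * ((3 + t + real b) * H2_weight t (Suc m, b))"
      using t H2_weight_le_Suc_fst[OF t] by (intro mult_left_mono) auto
    with step show ?case by (simp add: Suc_diff_le mult_ac)
  qed simp
  finally show ?thesis .
qed

text \<open>The index set \<open>K\<close> may exceed the support, so that several polynomials can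
  be compared over a common set and the triangle inequality for \<open>L2_set\<close>
  applies.\<close>

lemma H2_norm_eq_L2_set:
  assumes "t \<ge> -2" "finite K" "Poly_Mapping.keys f \<subseteq> K"
  shows "H2_norm t f = L2_set (\<lambda>p. cmod (Poly_Mapping.lookup f p) * sqrt (H2_weight t p)) K"
proof -
  have "Re (z * cnj z * of_real w) = (cmod z * sqrt w)\<^sup>2" if "w > 0" for z :: complex and w
  proof -
    have "z * cnj z * of_real w = of_real ((cmod z)\<^sup>2 * w)"
      by (simp only: complex_norm_square of_real_mult)
    then show ?thesis using that by (simp add: power_mult_distrib)
  qed
  then have "Re (H2_inner t f f) =
      (\<Sum>p\<in>Poly_Mapping.keys f. (cmod (Poly_Mapping.lookup f p) * sqrt (H2_weight t p))\<^sup>2)"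
    unfolding H2_inner_def using H2_weight_pos[OF assms(1)] by simp
  also have "\<dots> = (\<Sum>p\<in>K. (cmod (Poly_Mapping.lookup f p) * sqrt (H2_weight t p))\<^sup>2)"
    using assms by (intro sum.mono_neutral_left) (auto simp: in_keys_iff)
  finally show ?thesis by (simp add: H2_norm_def L2_set_def)
qed

lemma H2_norm_zero [simp]: "H2_norm t 0 = 0"
  by (simp add: H2_norm_def H2_inner_def)

lemma H2_norm_nonneg:
  assumes "t \<ge> -2"
  shows "H2_norm t f \<ge> 0"
  using H2_norm_eq_L2_set[OF assms finite_keys order_refl] by simp

lemma H2_norm_add_le:
  assumes "t \<ge> -2"
  shows "H2_norm t (f + g) \<le> H2_norm t f + H2_norm t g"
proof -
  let ?K = "Poly_Mapping.keys f \<union> Poly_Mapping.keys g"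
  let ?w = "\<lambda>p. sqrt (H2_weight t p)"
  have "H2_norm t (f + g) = L2_set (\<lambda>p. cmod (Poly_Mapping.lookup (f + g) p) * ?w p) ?K"
    by (intro H2_norm_eq_L2_set assms keys_add) auto
  also have "\<dots> \<le> L2_set (\<lambda>p. cmod (Poly_Mapping.lookup f p) * ?w p +
      cmod (Poly_Mapping.lookup g p) * ?w p) ?K"
    using H2_weight_pos[OF assms]
    by (intro L2_set_mono)
      (auto simp: lookup_add less_imp_le norm_triangle_ineq mult_right_mono simp flip: distrib_right)
  also have "\<dots> \<le> L2_set (\<lambda>p. cmod (Poly_Mapping.lookup f p) * ?w p) ?K +
      L2_set (\<lambda>p. cmod (Poly_Mapping.lookup g p) * ?w p) ?K"
    by (rule L2_set_triangle_ineq)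
  also have "\<dots> = H2_norm t f + H2_norm t g"
    using assms by (subst (1 2) H2_norm_eq_L2_set[of t ?K]) auto
  finally show ?thesis .
qed

lemma H2_norm_uminus: "H2_norm t (- f) = H2_norm t f"
  by (simp add: H2_norm_def H2_inner_def)

lemma H2_norm_diff_le:
  assumes "t \<ge> -2"
  shows "H2_norm t (f - g) \<le> H2_norm t f + H2_norm t g"
  using H2_norm_add_le[OF assms, of f "- g"] by (simp add: H2_norm_uminus)

lemma H2_norm_sum_le:
  assumes "t \<ge> -2"
  shows "H2_norm t (\<Sum>x\<in>X. f x) \<le> (\<Sum>x\<in>X. H2_norm t (f x))"
proof (induction X rule: infinite_finite_induct)
  case (insert x X)
  then show ?case using H2_norm_add_le[OF assms, of "f x" "sum f X"] by simp
qed auto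

lemma H2_norm_single:
  assumes "t \<ge> -2"
  shows "H2_norm t (Poly_Mapping.single p c) = cmod c * sqrt (H2_weight t p)"
  using H2_norm_eq_L2_set[OF assms, of "{p}" "Poly_Mapping.single p c"] H2_weight_pos[OF assms, of p]
  by simp

lemma coeff_le_H2_norm:
  assumes "t \<ge> -2"
  shows "cmod (Poly_Mapping.lookup f p) * sqrt (H2_weight t p) \<le> H2_norm t f"
proof -
  have "cmod (Poly_Mapping.lookup f p) * sqrt (H2_weight t p) \<le>
      L2_set (\<lambda>p. cmod (Poly_Mapping.lookup f p) * sqrt (H2_weight t p))
        (insert p (Poly_Mapping.keys f))"
    by (rule member_le_L2_set[where f = "\<lambda>p. cmod (Poly_Mapping.lookup f p) * sqrt (H2_weight t p)"])
      auto
  also have "\<dots> = H2_norm t f"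
    using H2_norm_eq_L2_set[OF assms, of "insert p (Poly_Mapping.keys f)" f]
    by (simp add: subset_insertI)
  finally show ?thesis .
qed

text \<open>Monomials are orthogonal: at each exponent one of the two coefficients vanishes, so the
  squared moduli add.\<close>

lemma H2_norm_add_power2:
  assumes t: "t \<ge> -2" and disj: "Poly_Mapping.keys f \<inter> Poly_Mapping.keys g = {}"
  shows "(H2_norm t (f + g))\<^sup>2 = (H2_norm t f)\<^sup>2 + (H2_norm t g)\<^sup>2"
proof -
  let ?K = "Poly_Mapping.keys f \<union> Poly_Mapping.keys g"
  have eq: "(H2_norm t v)\<^sup>2 = (\<Sum>p\<in>?K. (cmod (Poly_Mapping.lookup v p) * sqrt (H2_weight t p))\<^sup>2)"
    if "Poly_Mapping.keys v \<subseteq> ?K" for v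
    using H2_norm_eq_L2_set[OF t _ that] by (simp add: L2_set_def sum_nonneg)
  have "Poly_Mapping.lookup f p = 0 \<or> Poly_Mapping.lookup g p = 0" for p
    using disj by (auto simp: in_keys_iff)
  then have "(cmod (Poly_Mapping.lookup (f + g) p))\<^sup>2 =
      (cmod (Poly_Mapping.lookup f p))\<^sup>2 + (cmod (Poly_Mapping.lookup g p))\<^sup>2" for p
    by (metis add_0 add.right_neutral lookup_add norm_zero zero_power2)
  then show ?thesis
    using keys_add[of f g]
    by (simp add: eq power_mult_distrib distrib_right sum.distrib)
qed

subsection \<open>Quasi homogeneous polynomials\<close>

lemma wdeg_add: "wdeg n (p + q) = wdeg n p + wdeg n q"
  by (simp add: wdeg_def algebra_simps)

lemma quasi_homogeneous_0 [simp]: "quasi_homogeneous n m 0"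
  by (simp add: quasi_homogeneous_def)

lemma quasi_homogeneous_add:
  "quasi_homogeneous n m f \<Longrightarrow> quasi_homogeneous n m g \<Longrightarrow> quasi_homogeneous n m (f + g)"
  using keys_add[of f g] by (fastforce simp: quasi_homogeneous_def)

lemma quasi_homogeneous_diff:
  "quasi_homogeneous n m f \<Longrightarrow> quasi_homogeneous n m g \<Longrightarrow> quasi_homogeneous n m (f - g)"
  using keys_diff[of f g] by (fastforce simp: quasi_homogeneous_def)

lemma quasi_homogeneous_single: "quasi_homogeneous n (wdeg n p) (Poly_Mapping.single p c)"
  by (simp add: quasi_homogeneous_def)

lemma quasi_homogeneous_mult:
  assumes "quasi_homogeneous n l f" "quasi_homogeneous n m g"
  shows "quasi_homogeneous n (l + m) (f * g)"
  unfolding quasi_homogeneous_def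
proof
  fix p assume "p \<in> Poly_Mapping.keys (f * g)"
  then obtain a b where "p = a + b" "a \<in> Poly_Mapping.keys f" "b \<in> Poly_Mapping.keys g"
    using keys_mult by blast
  then show "wdeg n p = l + m"
    using assms by (simp add: quasi_homogeneous_def wdeg_add)
qed

section \<open>Monomial expansions and components of fixed quasi degree\<close>

lemma sum_single_keys:
  "(\<Sum>p\<in>Poly_Mapping.keys f. Poly_Mapping.single p (Poly_Mapping.lookup f p)) = f"
  by (rule poly_mapping_eqI) (simp add: lookup_sum lookup_single when_def in_keys_iff)

lemma single_times:
  fixes f :: bipoly
  shows "Poly_Mapping.single e c * f =
    (\<Sum>p\<in>Poly_Mapping.keys f. Poly_Mapping.single (e + p) (c * Poly_Mapping.lookup f p))"
  by (subst sum_single_keys[of f, symmetric]) (simp only: sum_distrib_left mult_single)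

lemma lookup_single_times:
  fixes f :: bipoly
  shows "Poly_Mapping.lookup (Poly_Mapping.single e c * f) (e + p) = c * Poly_Mapping.lookup f p"
  by (simp add: single_times lookup_sum lookup_single when_def in_keys_iff)

text \<open>The projection onto degree \<open>d\<close> in the grading of the ring by
  \<open>wdeg n\<close>.\<close>

definition qh_part :: "nat \<times> nat \<Rightarrow> nat \<Rightarrow> bipoly \<Rightarrow> bipoly" where
  "qh_part n d h = (\<Sum>p\<in>{p \<in> Poly_Mapping.keys h. wdeg n p = d}.
     Poly_Mapping.single p (Poly_Mapping.lookup h p))"

lemma lookup_qh_part:
  "Poly_Mapping.lookup (qh_part n d h) p = (if wdeg n p = d then Poly_Mapping.lookup h p else 0)"
  by (simp add: qh_part_def lookup_sum lookup_single when_def in_keys_iff)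

lemma quasi_homogeneous_qh_part: "quasi_homogeneous n d (qh_part n d h)"
  by (auto simp: quasi_homogeneous_def in_keys_iff lookup_qh_part split: if_splits)

lemma qh_part_0 [simp]: "qh_part n d 0 = 0"
  by (simp add: qh_part_def)

lemma qh_part_add: "qh_part n d (f + g) = qh_part n d f + qh_part n d g"
  by (rule poly_mapping_eqI) (simp add: lookup_qh_part lookup_add)

lemma qh_part_sum: "qh_part n d (\<Sum>x\<in>X. f x) = (\<Sum>x\<in>X. qh_part n d (f x))"
  by (induction X rule: infinite_finite_induct) (auto simp: qh_part_add)

lemma qh_part_quasi_homogeneous:
  assumes "quasi_homogeneous n m f"
  shows "qh_part n d f = (if m = d then f else 0)"
  using assms by (intro poly_mapping_eqI) (auto simp: lookup_qh_part quasi_homogeneous_def in_keys_iff)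

lemma sum_qh_part: "(\<Sum>d\<in>wdeg n ` Poly_Mapping.keys h. qh_part n d h) = h"
  by (rule poly_mapping_eqI) (auto simp: lookup_sum lookup_qh_part in_keys_iff)

text \<open>Pythagoras, since polynomials of different quasi degrees have no exponent in
  common.\<close>

lemma H2_norm_sum_power2:
  assumes t: "t \<ge> -2" and "finite D" and "\<And>d. d \<in> D \<Longrightarrow> quasi_homogeneous n d (v d)"
  shows "(H2_norm t (\<Sum>d\<in>D. v d))\<^sup>2 = (\<Sum>d\<in>D. (H2_norm t (v d))\<^sup>2)"
  using assms(2,3)
proof (induction D rule: finite_induct)
  case (insert d D)
  have "Poly_Mapping.keys (sum v D) \<subseteq> (\<Union>e\<in>D. Poly_Mapping.keys (v e))"
    by (rule keys_sum)
  moreover have "Poly_Mapping.keys (v d) \<inter> Poly_Mapping.keys (v e) = {}" if "e \<in> D" for e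
    using insert.prems[of d] insert.prems[of e] insert.hyps(2) that
    by (auto simp: quasi_homogeneous_def)
  ultimately have "Poly_Mapping.keys (v d) \<inter> Poly_Mapping.keys (sum v D) = {}"
    by blast
  then show ?case
    using insert by (simp add: H2_norm_add_power2[OF t])
qed simp

lemma quasi_homogeneous_ideal_subspace:
  assumes "quasi_homogeneous_ideal n I"
  shows "module.subspace (*) I"
  using assms module.subspace_span[OF module_times]
  by (auto simp: quasi_homogeneous_ideal_def ideal_generated_by_def)

text \<open>The ideal is graded, which permits division in one quasi degree at a time. In a product
  \<open>c * s\<close> with a generator \<open>s\<close>, expand \<open>c\<close> into monomials;
  each monomial multiple of \<open>s\<close> is quasi homogeneous, so its component is the multiple
  itself or zero.\<close>

lemma quasi_homogeneous_ideal_qh_part: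
  assumes I: "quasi_homogeneous_ideal n I" and "h \<in> I"
  shows "qh_part n d h \<in> I"
proof -
  interpret module "(*) :: bipoly \<Rightarrow> bipoly \<Rightarrow> bipoly" by (rule module_times)
  obtain S where S: "\<And>s. s \<in> S \<Longrightarrow> \<exists>m. quasi_homogeneous n m s" and IS: "I = span S"
    using I by (auto simp: quasi_homogeneous_ideal_def ideal_generated_by_def)
  have "h \<in> span S" using \<open>h \<in> I\<close> IS by simp
  then show ?thesis unfolding IS
  proof (induction rule: span_induct_alt)
    case base
    then show ?case by (simp add: span_zero)
  next
    case (step c s y)
    obtain m where m: "quasi_homogeneous n m s" using S[OF step(1)] ..
    have "qh_part n d (Poly_Mapping.single p a * s) \<in> span S" for p a
      using qh_part_quasi_homogeneous[OF quasi_homogeneous_mult[OF quasi_homogeneous_single m]]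
        span_scale[OF span_base[OF step(1)]] by (simp add: span_zero)
    then have "qh_part n d (c * s) \<in> span S"
      by (subst sum_single_keys[of c, symmetric]) (simp add: sum_distrib_right qh_part_sum span_sum)
    then show ?case using step by (simp add: qh_part_add span_add)
  qed
qed

subsection \<open>Division\<close>

text \<open>The multiplier of \<open>f\<close> in one step of the division algorithm; a monomial multiple only if
  \<open>lead_exp n f\<close> divides \<open>lead_exp n h\<close>, since subtraction of exponents is truncated.\<close>

definition quot_term :: "nat \<times> nat \<Rightarrow> bipoly \<Rightarrow> bipoly \<Rightarrow> bipoly" where
  "quot_term n h f = Poly_Mapping.single (lead_exp n h - lead_exp n f)
     (Poly_Mapping.lookup h (lead_exp n h) / Poly_Mapping.lookup f (lead_exp n f))"

text \<open>Divisibility of monomials, in terms of exponents.\<close>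

definition exp_le :: "nat \<times> nat \<Rightarrow> nat \<times> nat \<Rightarrow> bool" where
  "exp_le p q \<longleftrightarrow> fst p \<le> fst q \<and> snd p \<le> snd q"

lemma exp_le_add: "exp_le q (p + q)"
  by (simp add: exp_le_def)

lemma diff_add_exp: "exp_le p q \<Longrightarrow> q - p + p = q"
  by (simp add: exp_le_def prod_eq_iff)

text \<open>Exponents of equal quasi degree lie on a line of negative slope, because both entries of
  \<open>n\<close> are positive.\<close>

lemma wdeg_eq_fst_less:
  assumes "fst n > 0" "snd n > 0" "wdeg n p = wdeg n q"
  shows "fst p < fst q \<longleftrightarrow> snd q < snd p"
proof -
  have eq: "fst n * fst p + snd n * snd p = fst n * fst q + snd n * snd q"
    using assms(3) by (simp add: wdeg_def)
  have "snd n * snd q < snd n * snd p" if "fst p < fst q"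
    using mult_strict_left_mono[OF that assms(1)] eq by linarith
  moreover have "fst n * fst p < fst n * fst q" if "snd q < snd p"
    using mult_strict_left_mono[OF that assms(2)] eq by linarith
  ultimately show ?thesis by auto
qed

text \<open>All exponents of \<open>f\<close> tie in quasi degree, so the order compares first
  exponents; the leading exponent has the largest first and hence the smallest second entry.\<close>

lemma quasi_homogeneous_lead_exp:
  assumes n: "fst n > 0" "snd n > 0" and f: "quasi_homogeneous n m f" "f \<noteq> 0"
  shows "lead_exp n f \<in> Poly_Mapping.keys f" and "wdeg n (lead_exp n f) = m"
    and "Poly_Mapping.lookup f (lead_exp n f) \<noteq> 0"
    and "\<And>p. p \<in> Poly_Mapping.keys f \<Longrightarrow> p = lead_exp n f \<or>
      fst p < fst (lead_exp n f) \<and> snd (lead_exp n f) < snd p"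
proof -
  show L: "lead_exp n f \<in> Poly_Mapping.keys f"
    using lead_exp_is_greatest(1)[OF n(2) f(2)] .
  then show "wdeg n (lead_exp n f) = m" "Poly_Mapping.lookup f (lead_exp n f) \<noteq> 0"
    using f(1) by (auto simp: quasi_homogeneous_def in_keys_iff)
  fix p assume p: "p \<in> Poly_Mapping.keys f"
  then have wdeg: "wdeg n p = wdeg n (lead_exp n f)"
    using L f(1) by (auto simp: quasi_homogeneous_def)
  then show "p = lead_exp n f \<or> fst p < fst (lead_exp n f) \<and> snd (lead_exp n f) < snd p"
    using lead_exp_is_greatest(2)[OF n(2) f(2) p] wdeg_eq_fst_less[OF n wdeg]
    by (auto simp: mon_less_def)
qed

lemma quasi_homogeneous_quot_term:
  assumes n: "fst n > 0" "snd n > 0"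
    and f: "quasi_homogeneous n m f" "f \<noteq> 0" and h: "quasi_homogeneous n d h" "h \<noteq> 0"
    and le: "exp_le (lead_exp n f) (lead_exp n h)"
  shows "quasi_homogeneous n d (quot_term n h f * f)"
proof -
  have "quasi_homogeneous n (wdeg n (lead_exp n h - lead_exp n f) + m) (quot_term n h f * f)"
    unfolding quot_term_def by (intro quasi_homogeneous_mult quasi_homogeneous_single f)
  also have "wdeg n (lead_exp n h - lead_exp n f) + m = wdeg n (lead_exp n h - lead_exp n f + lead_exp n f)"
    by (simp only: wdeg_add quasi_homogeneous_lead_exp(2)[OF n f])
  also have "\<dots> = d"
    unfolding diff_add_exp[OF le] by (rule quasi_homogeneous_lead_exp(2)[OF n h])
  finally show ?thesis .
qed

text \<open>The leading terms cancel, and every other monomial of either polynomial lies strictly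
  further along the line of fixed quasi degree. The drop in the first exponent makes division
  terminate; the rise in the second bounds the number of steps that need an estimate.\<close>

lemma keys_lead_reduct:
  assumes n: "fst n > 0" "snd n > 0"
    and f: "quasi_homogeneous n m f" "f \<noteq> 0" and h: "quasi_homogeneous n d h" "h \<noteq> 0"
    and le: "exp_le (lead_exp n f) (lead_exp n h)"
    and p: "p \<in> Poly_Mapping.keys (h - quot_term n h f * f)"
  shows "fst p < fst (lead_exp n h) \<and> snd (lead_exp n h) < snd p"
proof -
  let ?e = "lead_exp n h - lead_exp n f"
  have "Poly_Mapping.lookup (quot_term n h f * f) (?e + lead_exp n f) =
      Poly_Mapping.lookup h (lead_exp n h)"
    unfolding quot_term_def lookup_single_times
    using quasi_homogeneous_lead_exp(3)[OF n f] by simp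
  then have "p \<noteq> lead_exp n h"
    unfolding diff_add_exp[OF le] using p by (metis in_keys_iff lookup_minus diff_self)
  have "p \<in> Poly_Mapping.keys h \<or> p \<in> Poly_Mapping.keys (quot_term n h f * f)"
    using subsetD[OF keys_diff p] by simp
  then show ?thesis
  proof
    assume "p \<in> Poly_Mapping.keys h"
    then show ?thesis
      using quasi_homogeneous_lead_exp(4)[OF n h, of p] \<open>p \<noteq> lead_exp n h\<close> by simp
  next
    assume "p \<in> Poly_Mapping.keys (quot_term n h f * f)"
    then obtain e k where "e \<in> Poly_Mapping.keys (quot_term n h f)"
      and k: "k \<in> Poly_Mapping.keys f" and "p = e + k"
      using subsetD[OF keys_mult] by blast
    then have pk: "p = ?e + k"
      unfolding quot_term_def by (simp only: keys_single split: if_splits) simp_all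
    have "k \<noteq> lead_exp n f"
      using \<open>p \<noteq> lead_exp n h\<close> unfolding pk by (rule contrapos_nn) (simp only: diff_add_exp[OF le])
    then have "fst k < fst (lead_exp n f) \<and> snd (lead_exp n f) < snd k"
      using quasi_homogeneous_lead_exp(4)[OF n f k] by simp
    then show ?thesis
      using le unfolding pk exp_le_def fst_add snd_add fst_diff snd_diff by linarith
  qed
qed

text \<open>The weights decrease in the second exponent, and a unit step down in the first exponent costs
  a factor of at most \<open>3 + t + b\<close>, where \<open>b\<close> is the second exponent.\<close>

lemma H2_norm_quot_term_le:
  assumes n: "fst n > 0" "snd n > 0" and t: "t \<ge> -2" and f: "quasi_homogeneous n m f" "f \<noteq> 0"
  obtains C where "C \<ge> 0" and
    "\<And>h. exp_le (lead_exp n f) (lead_exp n h) \<Longrightarrow> snd (lead_exp n h) \<le> q \<Longrightarrow>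
       H2_norm t (quot_term n h f * f) \<le> C * H2_norm t h"
proof
  let ?l = "lead_exp n f"
  \<comment> \<open>\<open>R p\<close> is the size of a coefficient relative to the leading one, and
    \<open>D p\<close> bounds the square root of the weight ratio. Neither depends on
    \<open>h\<close>, so the sum of \<open>R p * D p\<close> serves as the constant.\<close>
  define R where "R p = cmod (Poly_Mapping.lookup f p) / cmod (Poly_Mapping.lookup f ?l)" for p
  define D where "D p = sqrt ((3 + t + real q) ^ (fst ?l - fst p))" for p :: "nat \<times> nat"
  show "(\<Sum>p\<in>Poly_Mapping.keys f. R p * D p) \<ge> 0"
    using t by (intro sum_nonneg) (simp add: R_def D_def)
  fix h assume le: "exp_le ?l (lead_exp n h)" and q: "snd (lead_exp n h) \<le> q"
  let ?L = "lead_exp n h"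
  let ?N = "cmod (Poly_Mapping.lookup h ?L) * sqrt (H2_weight t ?L)"
  have weight: "sqrt (H2_weight t (?L - ?l + p)) \<le> D p * sqrt (H2_weight t ?L)"
    if p: "p \<in> Poly_Mapping.keys f" for p
  proof -
    have "fst p \<le> fst ?l" "snd ?l \<le> snd p"
      using quasi_homogeneous_lead_exp(4)[OF n f p] by auto
    then have le': "fst (?L - ?l + p) \<le> fst ?L" "snd ?L \<le> snd (?L - ?l + p)"
      and e: "fst ?L - fst (?L - ?l + p) = fst ?l - fst p"
      using le by (auto simp: exp_le_def)
    have "H2_weight t (?L - ?l + p) \<le> (3 + t + real (snd ?L)) ^ (fst ?l - fst p) * H2_weight t ?L"
      using H2_weight_le[OF t le'] unfolding e prod.collapse .
    \<comment> \<open>Here the bound \<open>q\<close> on the second exponent removes the dependence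
      on \<open>h\<close>.\<close>
    also have "\<dots> \<le> (3 + t + real q) ^ (fst ?l - fst p) * H2_weight t ?L"
      using t q H2_weight_pos[OF t, of ?L] by (intro mult_right_mono power_mono) auto
    finally show ?thesis
      by (simp add: D_def flip: real_sqrt_mult)
  qed
  have "H2_norm t (quot_term n h f * f) \<le> (\<Sum>p\<in>Poly_Mapping.keys f.
      cmod (Poly_Mapping.lookup h ?L) * R p * sqrt (H2_weight t (?L - ?l + p)))"
    unfolding quot_term_def single_times
    by (rule order_trans[OF H2_norm_sum_le[OF t]]) (simp add: H2_norm_single[OF t] norm_mult norm_divide R_def)
  also have "\<dots> \<le> (\<Sum>p\<in>Poly_Mapping.keys f.
      cmod (Poly_Mapping.lookup h ?L) * R p * (D p * sqrt (H2_weight t ?L)))"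
    by (intro sum_mono mult_left_mono weight) (auto simp: R_def)
  also have "\<dots> = (\<Sum>p\<in>Poly_Mapping.keys f. R p * D p) * ?N"
    by (simp add: sum_distrib_left sum_distrib_right mult_ac)
  \<comment> \<open>Only the leading coefficient of \<open>h\<close> enters, and by orthogonality a
    single term is bounded by the whole norm.\<close>
  also have "\<dots> \<le> (\<Sum>p\<in>Poly_Mapping.keys f. R p * D p) * H2_norm t h"
    by (rule mult_left_mono[OF coeff_le_H2_norm[OF t] \<open>_ \<ge> 0\<close>])
  finally show "H2_norm t (quot_term n h f * f) \<le> (\<Sum>p\<in>Poly_Mapping.keys f. R p * D p) * H2_norm t h" .
qed

text \<open>A common setting for both assertions of the theorem, in which the Groebner property
  takes the form of divisibility of leading monomials, \<open>lead_dvd\<close>. Zero is excluded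
  there because \<open>lead_exp\<close> is meaningful only for nonzero polynomials.\<close>

locale quasi_homogeneous_basis =
  fixes n :: "nat \<times> nat" and I F :: "bipoly set"
  assumes n: "fst n > 0" "snd n > 0"
    and ideal: "quasi_homogeneous_ideal n I"
    and finite: "finite F" and subset: "F \<subseteq> I"
    and homogeneous: "\<And>f. f \<in> F \<Longrightarrow> \<exists>m. quasi_homogeneous n m f"
    and lead_dvd: "\<And>h. h \<in> I \<Longrightarrow> h \<noteq> 0 \<Longrightarrow> \<exists>f\<in>F - {0}. exp_le (lead_exp n f) (lead_exp n h)"
begin

lemma reduct_in_ideal: "h \<in> I \<Longrightarrow> f \<in> F \<Longrightarrow> h - u * f \<in> I"
  using module.subspace_diff[OF module_times] module.subspace_scale[OF module_times]
    quasi_homogeneous_ideal_subspace[OF ideal] subset by blast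

text \<open>Some basis element has a leading monomial dividing that of \<open>h\<close>, and its
  first exponent is at least that of \<open>f0\<close>. With the second exponents of
  \<open>h\<close> large enough, the leading monomial of \<open>f0\<close> divides as well. The
  remainder satisfies the same conditions with a smaller strict bound \<open>j\<close> on first
  exponents, and \<open>j = 0\<close> forces \<open>h = 0\<close>.\<close>

lemma multiple_of_min:
  assumes f0: "f0 \<in> F" "f0 \<noteq> 0"
    and min: "\<And>f. f \<in> F \<Longrightarrow> f \<noteq> 0 \<Longrightarrow> fst (lead_exp n f0) \<le> fst (lead_exp n f)"
    and "h \<in> I" "quasi_homogeneous n d h"
    and "\<And>p. p \<in> Poly_Mapping.keys h \<Longrightarrow> snd (lead_exp n f0) \<le> snd p"
    and "\<And>p. p \<in> Poly_Mapping.keys h \<Longrightarrow> fst p < j"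
  shows "\<exists>g. h = g * f0"
  using assms(4-7)
proof (induction j arbitrary: h)
  case 0
  then have "h = 0" by (metis all_not_in_conv keys_eq_empty not_less_zero)
  then show ?case by (intro exI[of _ 0]) simp
next
  case (Suc j)
  show ?case
  proof (cases "h = 0")
    case True
    then show ?thesis by (intro exI[of _ 0]) simp
  next
    case False
    note hom = \<open>quasi_homogeneous n d h\<close>
    let ?h = "h - quot_term n h f0 * f0"
    obtain m where m: "quasi_homogeneous n m f0" using homogeneous f0 by blast
    have L: "lead_exp n h \<in> Poly_Mapping.keys h"
      by (rule quasi_homogeneous_lead_exp(1)[OF n hom False])
    obtain f where "f \<in> F - {0}" "exp_le (lead_exp n f) (lead_exp n h)"
      using lead_dvd[OF \<open>h \<in> I\<close> False] by blast
    then have le: "exp_le (lead_exp n f0) (lead_exp n h)"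
      using min[of f] Suc.prems(3)[OF L] by (auto simp: exp_le_def)
    have keys: "fst p < fst (lead_exp n h) \<and> snd (lead_exp n h) < snd p"
      if "p \<in> Poly_Mapping.keys ?h" for p
      using keys_lead_reduct[OF n m f0(2) hom False le that] .
    have "\<exists>g. ?h = g * f0"
    proof (rule Suc.IH)
      show "?h \<in> I" by (rule reduct_in_ideal[OF \<open>h \<in> I\<close> f0(1)])
      show "quasi_homogeneous n d ?h"
        by (rule quasi_homogeneous_diff[OF hom quasi_homogeneous_quot_term[OF n m f0(2) hom False le]])
      show "snd (lead_exp n f0) \<le> snd p" if "p \<in> Poly_Mapping.keys ?h" for p
        using keys[OF that] Suc.prems(3)[OF L] by simp
      show "fst p < j" if "p \<in> Poly_Mapping.keys ?h" for p
        using keys[OF that] Suc.prems(4)[OF L] by simp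
    qed
    then obtain g where "?h = g * f0" ..
    then have "h = (g + quot_term n h f0) * f0" by (simp add: algebra_simps)
    then show ?thesis ..
  qed
qed

text \<open>The summands are bounded one by one and keep the quasi degree \<open>d\<close>, so that
  orthogonality can be applied to each of them when the degrees are assembled.\<close>

definition stable_quotients :: "real \<Rightarrow> real \<Rightarrow> nat \<Rightarrow> bipoly \<Rightarrow> (bipoly \<Rightarrow> bipoly) \<Rightarrow> bool" where
  "stable_quotients t A d h g \<longleftrightarrow> h = (\<Sum>f\<in>F. g f * f) \<and>
     (\<forall>f\<in>F. quasi_homogeneous n d (g f * f) \<and> H2_norm t (g f * f) \<le> A * H2_norm t h)"

lemma stable_quotients_0: "stable_quotients t A d 0 (\<lambda>_. 0)"
  by (simp add: stable_quotients_def)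

text \<open>The only summand that can be nonzero is \<open>h\<close> itself, so every constant
  \<open>A >= 1\<close> works.\<close>

lemma stable_quotients_high:
  assumes t: "t \<ge> -2" and "A \<ge> 1" and q: "\<And>f. f \<in> F \<Longrightarrow> f \<noteq> 0 \<Longrightarrow> snd (lead_exp n f) \<le> q"
    and h: "h \<in> I" "quasi_homogeneous n d h" "\<And>p. p \<in> Poly_Mapping.keys h \<Longrightarrow> q \<le> snd p"
  shows "\<exists>g. stable_quotients t A d h g"
proof (cases "h = 0")
  case True
  then show ?thesis using stable_quotients_0 by blast
next
  case False
  then have "F - {0} \<noteq> {}" using lead_dvd h(1) by blast
  then obtain f0 where f0: "f0 \<in> F" "f0 \<noteq> 0"
    and min: "\<And>f. f \<in> F \<Longrightarrow> f \<noteq> 0 \<Longrightarrow> fst (lead_exp n f0) \<le> fst (lead_exp n f)"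
    using ex_min_if_finite[of "(\<lambda>f. fst (lead_exp n f)) ` (F - {0})"] finite
    by (force simp: not_less)
  have "\<exists>g. h = g * f0"
  proof (rule multiple_of_min[OF f0 min h(1,2)])
    show "snd (lead_exp n f0) \<le> snd p" if "p \<in> Poly_Mapping.keys h" for p
      using q[OF f0] h(3)[OF that] by simp
    \<comment> \<open>\<open>multiple_of_min\<close> needs a strict bound, hence the successor of
      the maximum.\<close>
    show "fst p < Suc (Max (fst ` Poly_Mapping.keys h))" if "p \<in> Poly_Mapping.keys h" for p
      using that by (simp add: less_Suc_eq_le)
  qed
  then obtain g where g: "h = g * f0" ..
  have "(\<Sum>f\<in>F. (if f = f0 then g else 0) * f) = (\<Sum>f\<in>F. if f = f0 then g * f else 0)"
    by (rule sum.cong) auto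
  then have "stable_quotients t A d h (\<lambda>f. if f = f0 then g else 0)"
    using finite f0 h(2) \<open>A \<ge> 1\<close> H2_norm_nonneg[OF t, of h]
    by (auto simp: stable_quotients_def mult_le_cancel_right1 simp flip: g)
  then show ?thesis by blast
qed

text \<open>Induction on \<open>j\<close>, the largest amount by which second exponents may fall
  short of \<open>q\<close>; one division step lowers it. The constant depends on \<open>j\<close>,
  but is chosen before \<open>d\<close> and \<open>h\<close>.\<close>

lemma stable_quotients_steps:
  assumes t: "t \<ge> -2" and q: "\<And>f. f \<in> F \<Longrightarrow> f \<noteq> 0 \<Longrightarrow> snd (lead_exp n f) \<le> q"
  shows "\<exists>A\<ge>1. \<forall>d h. h \<in> I \<longrightarrow> quasi_homogeneous n d h \<longrightarrow>
    (\<forall>p\<in>Poly_Mapping.keys h. q \<le> snd p + j) \<longrightarrow> (\<exists>g. stable_quotients t A d h g)"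
proof (induction j)
  case 0
  then show ?case
    using stable_quotients_high[OF t order_refl q] by (intro exI[of _ 1]) auto
next
  case (Suc j)
  then obtain A where A: "A \<ge> 1" and IH: "\<And>d h. h \<in> I \<Longrightarrow> quasi_homogeneous n d h \<Longrightarrow>
      (\<And>p. p \<in> Poly_Mapping.keys h \<Longrightarrow> q \<le> snd p + j) \<Longrightarrow> \<exists>g. stable_quotients t A d h g"
    by blast
  have "\<exists>C\<ge>0. \<forall>h. exp_le (lead_exp n f) (lead_exp n h) \<longrightarrow> snd (lead_exp n h) \<le> q \<longrightarrow>
       H2_norm t (quot_term n h f * f) \<le> C * H2_norm t h" if "f \<in> F - {0}" for f
    using that homogeneous[of f] H2_norm_quot_term_le[OF n t] by (metis DiffE singletonI)
  then obtain C where C0: "\<And>f. f \<in> F - {0} \<Longrightarrow> C f \<ge> 0"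
    and C: "\<And>f h. f \<in> F - {0} \<Longrightarrow> exp_le (lead_exp n f) (lead_exp n h) \<Longrightarrow>
       snd (lead_exp n h) \<le> q \<Longrightarrow> H2_norm t (quot_term n h f * f) \<le> C f * H2_norm t h"
    by metis
  \<comment> \<open>The sum dominates each \<open>C f\<close> and also makes sense when
    \<open>F - {0}\<close> is empty.\<close>
  define B where "B = (\<Sum>f\<in>F - {0}. C f)"
  have B: "C f \<le> B" if "f \<in> F - {0}" for f
    unfolding B_def using that finite C0 by (intro member_le_sum) auto
  have B0: "B \<ge> 0" unfolding B_def using C0 by (intro sum_nonneg)
  \<comment> \<open>The remainder has norm at most \<open>1 + B\<close> times that of
    \<open>h\<close>, which gives \<open>A * (1 + B)\<close> for its quotients; the term split off
    by the step adds another \<open>B\<close> to one summand.\<close>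
  define A' where "A' = A * (1 + B) + B"
  have AA': "A \<le> A'" using A B0 by (simp add: A'_def algebra_simps)
  have "\<exists>g. stable_quotients t A' d h g"
    if h: "h \<in> I" "quasi_homogeneous n d h"
      and keys: "\<And>p. p \<in> Poly_Mapping.keys h \<Longrightarrow> q \<le> snd p + Suc j" for d h
  proof (cases "\<forall>p\<in>Poly_Mapping.keys h. q \<le> snd p + j")
    case True
    then obtain g where g: "stable_quotients t A d h g" using IH[OF h] by blast
    have "A * H2_norm t h \<le> A' * H2_norm t h"
      by (intro mult_right_mono AA' H2_norm_nonneg t)
    with g have "stable_quotients t A' d h g"
      unfolding stable_quotients_def by force
    then show ?thesis by blast
  next
    case False
    then obtain p where p: "p \<in> Poly_Mapping.keys h" "snd p + j < q" by (auto simp: not_le)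
    then have "h \<noteq> 0" by auto
    note L = quasi_homogeneous_lead_exp[OF n h(2) \<open>h \<noteq> 0\<close>]
    \<comment> \<open>The exponent \<open>p\<close> attains the permitted shortfall
      \<open>Suc j\<close>, and the leading exponent has the least second entry, so it attains it
      too. All exponents of the remainder then fall short by at most \<open>j\<close>.\<close>
    have Lq: "snd (lead_exp n h) + Suc j = q"
      using keys[OF L(1)] keys[OF p(1)] p(2) L(4)[OF p(1)] by auto
    obtain f where f: "f \<in> F - {0}" and le: "exp_le (lead_exp n f) (lead_exp n h)"
      using lead_dvd[OF h(1) \<open>h \<noteq> 0\<close>] by blast
    then obtain m where m: "quasi_homogeneous n m f" using homogeneous by blast
    let ?u = "quot_term n h f"
    let ?h = "h - ?u * f"
    have u: "quasi_homogeneous n d (?u * f)"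
      using quasi_homogeneous_quot_term[OF n m _ h(2) \<open>h \<noteq> 0\<close> le] f by blast
    have "H2_norm t (?u * f) \<le> C f * H2_norm t h" using C[OF f le] Lq by simp
    also have "\<dots> \<le> B * H2_norm t h" by (intro mult_right_mono B f H2_norm_nonneg t)
    finally have uB: "H2_norm t (?u * f) \<le> B * H2_norm t h" .
    have "\<exists>g. stable_quotients t A d ?h g"
    proof (rule IH)
      show "?h \<in> I" using reduct_in_ideal h(1) f by blast
      show "quasi_homogeneous n d ?h" by (rule quasi_homogeneous_diff[OF h(2) u])
      show "q \<le> snd p + j" if "p \<in> Poly_Mapping.keys ?h" for p
        using keys_lead_reduct[OF n m _ h(2) \<open>h \<noteq> 0\<close> le that] f Lq by auto
    qed
    then obtain g where g: "stable_quotients t A d ?h g" by blast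
    have hB: "H2_norm t ?h \<le> (1 + B) * H2_norm t h"
      using H2_norm_diff_le[OF t, of h "?u * f"] uB by (simp add: algebra_simps)
    have AhB: "A * H2_norm t ?h \<le> A * (1 + B) * H2_norm t h"
      using mult_left_mono[OF hB, of A] A by (simp add: mult_ac)
    let ?g = "\<lambda>e. g e + (if e = f then ?u else 0)"
    have "(\<Sum>e\<in>F. ?g e * e) = (\<Sum>e\<in>F. g e * e + (if e = f then ?u * f else 0))"
      by (rule sum.cong) (auto simp: algebra_simps)
    also have "\<dots> = ?h + ?u * f"
      using g f finite by (simp add: sum.distrib stable_quotients_def)
    finally have sum: "h = (\<Sum>e\<in>F. ?g e * e)" by simp
    have "H2_norm t (?g e * e) \<le> A' * H2_norm t h \<and> quasi_homogeneous n d (?g e * e)"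
      if e: "e \<in> F" for e
    proof -
      have ge: "H2_norm t (g e * e) \<le> A * (1 + B) * H2_norm t h" "quasi_homogeneous n d (g e * e)"
        using g e AhB unfolding stable_quotients_def by force+
      show ?thesis
      proof (cases "e = f")
        case True
        then show ?thesis
          using ge uB u H2_norm_add_le[OF t, of "g e * e" "?u * f"]
          by (auto simp: A'_def distrib_right intro: quasi_homogeneous_add)
      next
        case False
        then show ?thesis
          using ge B0 mult_nonneg_nonneg[OF B0 H2_norm_nonneg[OF t, of h]]
          by (simp add: A'_def distrib_right)
      qed
    qed
    with sum have "stable_quotients t A' d h ?g"
      unfolding stable_quotients_def by blast
    then show ?thesis by blast
  qed
  with A AA' show ?case by (intro exI[of _ A']) auto
qed

lemma ex_stable_quotients:
  assumes t: "t \<ge> -2"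
  obtains A where "A \<ge> 1"
    and "\<And>d h. h \<in> I \<Longrightarrow> quasi_homogeneous n d h \<Longrightarrow> \<exists>g. stable_quotients t A d h g"
proof -
  define q where "q = (\<Sum>f\<in>F. snd (lead_exp n f))"
  have "snd (lead_exp n f) \<le> q" if "f \<in> F" for f
    unfolding q_def by (rule member_le_sum) (use that finite in auto)
  \<comment> \<open>For \<open>j = q\<close> the condition on second exponents holds
    trivially.\<close>
  then show ?thesis
    using stable_quotients_steps[OF t, of q q] that by auto
qed

text \<open>Each component of \<open>h\<close> is divided separately with the same constant
  \<open>A\<close>. The resulting components of \<open>g f * f\<close> are again orthogonal, so the
  estimates add in squares, however many degrees occur.\<close>

theorem stable_generating_set_H2:
  assumes t: "t \<ge> -2"
  shows "stable_generating_set (H2_norm t) I F"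
proof -
  obtain A where A: "A \<ge> 1"
    and ex: "\<And>d h. h \<in> I \<Longrightarrow> quasi_homogeneous n d h \<Longrightarrow> \<exists>g. stable_quotients t A d h g"
    using ex_stable_quotients[OF t] by blast
  have "\<exists>g. h = (\<Sum>f\<in>F. g f * f) \<and> (\<Sum>f\<in>F. H2_norm t (g f * f)) \<le> card F * A * H2_norm t h"
    if h: "h \<in> I" for h
  proof -
    let ?D = "wdeg n ` Poly_Mapping.keys h"
    have "\<forall>d. \<exists>g. stable_quotients t A d (qh_part n d h) g"
      using ex quasi_homogeneous_ideal_qh_part[OF ideal h] quasi_homogeneous_qh_part by blast
    then obtain G where G: "\<And>d. stable_quotients t A d (qh_part n d h) (G d)" by metis
    define g where "g f = (\<Sum>d\<in>?D. G d f)" for f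
    have "(\<Sum>f\<in>F. g f * f) = (\<Sum>d\<in>?D. \<Sum>f\<in>F. G d f * f)"
      unfolding g_def sum_distrib_right by (rule sum.swap)
    also have "\<dots> = (\<Sum>d\<in>?D. qh_part n d h)"
      using G by (simp add: stable_quotients_def)
    finally have sum: "h = (\<Sum>f\<in>F. g f * f)" by (simp add: sum_qh_part)
    have "H2_norm t (g f * f) \<le> A * H2_norm t h" if f: "f \<in> F" for f
    proof (rule power2_le_imp_le)
      have "(H2_norm t (g f * f))\<^sup>2 = (\<Sum>d\<in>?D. (H2_norm t (G d f * f))\<^sup>2)"
        unfolding g_def sum_distrib_right using G f
        by (intro H2_norm_sum_power2[OF t]) (auto simp: stable_quotients_def)
      also have "\<dots> \<le> (\<Sum>d\<in>?D. (A * H2_norm t (qh_part n d h))\<^sup>2)"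
        using G f unfolding stable_quotients_def by (intro sum_mono power_mono H2_norm_nonneg[OF t]) blast
      also have "\<dots> = A\<^sup>2 * (\<Sum>d\<in>?D. (H2_norm t (qh_part n d h))\<^sup>2)"
        by (simp add: power_mult_distrib sum_distrib_left)
      also have "(\<Sum>d\<in>?D. (H2_norm t (qh_part n d h))\<^sup>2) = (H2_norm t (\<Sum>d\<in>?D. qh_part n d h))\<^sup>2"
        by (rule H2_norm_sum_power2[OF t, symmetric, where n = n])
          (simp_all only: quasi_homogeneous_qh_part finite_imageI finite_keys)
      finally show "(H2_norm t (g f * f))\<^sup>2 \<le> (A * H2_norm t h)\<^sup>2"
        by (simp add: sum_qh_part power_mult_distrib)
      show "0 \<le> A * H2_norm t h"
        using A H2_norm_nonneg[OF t, of h] by simp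
    qed
    \<comment> \<open>The factor \<open>card F\<close> comes only from summing the individual
      bounds.\<close>
    then have "(\<Sum>f\<in>F. H2_norm t (g f * f)) \<le> card F * (A * H2_norm t h)"
      by (rule sum_bounded_above)
    with sum show ?thesis by (auto simp: mult.assoc)
  qed
  then show ?thesis
    unfolding stable_generating_set_def using finite subset by blast
qed

end

subsection \<open>Groebner bases\<close>

text \<open>In an ideal generated by monomials, every monomial of an element is divisible by one of
  the generators.\<close>

lemma groebner_basis_lead_dvd:
  assumes n: "fst n > 0" "snd n > 0" and G: "groebner_basis n I F" and h: "h \<in> I" "h \<noteq> 0"
  shows "\<exists>f\<in>F - {0}. exp_le (lead_exp n f) (lead_exp n h)"
proof -
  interpret module "(*) :: bipoly \<Rightarrow> bipoly \<Rightarrow> bipoly" by (rule module_times)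
  have "lead_term n h \<in> span (lead_term n ` (F - {0}))"
    using G h span_base[of "lead_term n h" "lead_term n ` (I - {0})"]
    by (auto simp: groebner_basis_def ideal_generated_by_def)
  \<comment> \<open>The claim is extended to all exponents of an arbitrary element of the span, so
    that it passes through sums and multiples.\<close>
  then have "\<forall>p\<in>Poly_Mapping.keys (lead_term n h). \<exists>f\<in>F - {0}. exp_le (lead_exp n f) p"
  proof (induction rule: span_induct_alt)
    case (step c s y)
    then obtain f where f: "f \<in> F - {0}" and s: "s = lead_term n f" by blast
    have "exp_le (lead_exp n f) p" if p: "p \<in> Poly_Mapping.keys (c * s)" for p
    proof -
      obtain a b where "p = a + b" "b \<in> Poly_Mapping.keys s"
        using subsetD[OF keys_mult p] by blast
      moreover from this(2) have "b = lead_exp n f"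
        unfolding s lead_term_def by (simp only: keys_single split: if_splits) simp_all
      ultimately show ?thesis by (simp only: exp_le_add)
    qed
    with f have "\<exists>f\<in>F - {0}. exp_le (lead_exp n f) p" if "p \<in> Poly_Mapping.keys (c * s)" for p
      using that by blast
    with step.IH show ?case using subsetD[OF keys_add[of "c * s" y]] by blast
  qed simp
  moreover have "Poly_Mapping.keys (lead_term n h) = {lead_exp n h}"
    using lead_exp_is_greatest(1)[OF n(2) h(2)] by (simp add: lead_term_def in_keys_iff)
  ultimately show ?thesis by simp
qed

text \<open>Dickson's lemma in two variables. Fix \<open>c\<close> in \<open>L\<close>: an element
  not above \<open>c\<close> lies in one of the finitely many columns left of \<open>c\<close> or
  rows below \<open>c\<close>, and in each of these the least element suffices.\<close>

lemma dickson_nat_pair: "\<exists>B\<subseteq>L. finite B \<and> (\<forall>l\<in>L. \<exists>b\<in>B. exp_le b l)"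
proof (cases "L = {}")
  case False
  then obtain c where c: "c \<in> L" by blast
  have least: "\<exists>b\<in>L. u b = i \<and> (\<forall>l\<in>L. u l = i \<longrightarrow> v b \<le> v l)" if "i \<in> u ` L"
    for i :: nat and u v :: "nat \<times> nat \<Rightarrow> nat"
    using that ex_has_least_nat[of "\<lambda>l. l \<in> L \<and> u l = i" _ v] by blast
  obtain P where P: "\<And>i. i \<in> fst ` L \<Longrightarrow> P i \<in> L \<and> fst (P i) = i \<and>
      (\<forall>l\<in>L. fst l = i \<longrightarrow> snd (P i) \<le> snd l)"
    using least[of _ fst snd] by metis
  obtain Q where Q: "\<And>i. i \<in> snd ` L \<Longrightarrow> Q i \<in> L \<and> snd (Q i) = i \<and>
      (\<forall>l\<in>L. snd l = i \<longrightarrow> fst (Q i) \<le> fst l)"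
    using least[of _ snd fst] by metis
  let ?B = "insert c (P ` ({..<fst c} \<inter> fst ` L) \<union> Q ` ({..<snd c} \<inter> snd ` L))"
  have "\<exists>b\<in>?B. exp_le b l" if l: "l \<in> L" for l
  proof -
    consider "exp_le c l" | "fst l < fst c" | "snd l < snd c"
      unfolding exp_le_def by linarith
    then show ?thesis
    proof cases
      case 2
      then have "exp_le (P (fst l)) l" "P (fst l) \<in> ?B" using l P[of "fst l"] by (simp_all add: exp_le_def)
      then show ?thesis by blast
    next
      case 3
      then have "exp_le (Q (snd l)) l" "Q (snd l) \<in> ?B" using l Q[of "snd l"] by (simp_all add: exp_le_def)
      then show ?thesis by blast
    qed auto
  qed
  moreover have "?B \<subseteq> L" using c P Q by blast
  moreover have "finite ?B" by simp
  ultimately show ?thesis by blast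
qed auto

text \<open>Dickson's lemma is applied to the leading exponents of nonzero quasi homogeneous
  elements of \<open>I\<close>. These are all leading exponents of \<open>I\<close>, since the
  component of \<open>h\<close> in its top quasi degree lies in \<open>I\<close> and has the same
  leading exponent as \<open>h\<close>.\<close>

lemma ex_quasi_homogeneous_basis:
  assumes n: "fst n > 0" "snd n > 0" and I: "quasi_homogeneous_ideal n I"
  shows "\<exists>F. quasi_homogeneous_basis n I F"
proof -
  define H where "H = {h \<in> I - {0}. \<exists>m. quasi_homogeneous n m h}"
  obtain B where B: "B \<subseteq> lead_exp n ` H" "finite B"
    and le: "\<And>h. h \<in> H \<Longrightarrow> \<exists>b\<in>B. exp_le b (lead_exp n h)"
    using dickson_nat_pair[of "lead_exp n ` H"] by blast
  obtain F where F: "F \<subseteq> H" "finite F" "B = lead_exp n ` F"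
    using finite_subset_image[OF B(2,1)] by blast
  have "quasi_homogeneous_basis n I F"
  proof
    fix h assume h: "h \<in> I" "h \<noteq> 0"
    let ?L = "lead_exp n h" and ?p = "qh_part n (wdeg n (lead_exp n h)) h"
    have L: "?L \<in> Poly_Mapping.keys ?p"
      using lead_exp_is_greatest(1)[OF n(2) h(2)] by (simp add: in_keys_iff lookup_qh_part)
    then have "?p \<noteq> 0" by auto
    have "lead_exp n ?p \<in> Poly_Mapping.keys h"
      using lead_exp_is_greatest(1)[OF n(2) \<open>?p \<noteq> 0\<close>]
      by (auto simp: in_keys_iff lookup_qh_part split: if_splits)
    \<comment> \<open>Each of the two exponents occurs in the other polynomial; if they differed,
      each would be smaller than the other.\<close>
    then have "lead_exp n ?p = ?L"
      using lead_exp_is_greatest(2)[OF n(2) h(2)] lead_exp_is_greatest(2)[OF n(2) \<open>?p \<noteq> 0\<close> L]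
      by (metis mon_less_def less_asym' less_irrefl)
    moreover have "?p \<in> H"
      using \<open>?p \<noteq> 0\<close> quasi_homogeneous_ideal_qh_part[OF I h(1)] quasi_homogeneous_qh_part
      unfolding H_def by blast
    ultimately show "\<exists>f\<in>F - {0}. exp_le (lead_exp n f) ?L"
      using le[of ?p] F by (force simp: H_def)
  qed (use F n I in \<open>auto simp: H_def\<close>)
  then show ?thesis ..
qed

theorem theorem3p5:
  fixes n :: "nat \<times> nat" and I :: "bipoly set"
  assumes "fst n > 0" and "snd n > 0"
    and "quasi_homogeneous_ideal n I"
  shows "(\<forall>t::real. t \<ge> -2 \<longrightarrow> stable_division_property (H2_norm t) I) \<and>
    (\<forall>F m. groebner_basis n I F \<and> (\<forall>f\<in>F. quasi_homogeneous n m f) \<longrightarrow>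
       (\<forall>t::real. t \<ge> -2 \<longrightarrow> stable_generating_set (H2_norm t) I F))"
proof (intro conjI allI impI)
  fix t :: real assume "t \<ge> -2"
  then show "stable_division_property (H2_norm t) I"
    using ex_quasi_homogeneous_basis[OF assms] quasi_homogeneous_basis.stable_generating_set_H2
    unfolding stable_division_property_def by blast
next
  fix F m and t :: real
  assume G: "groebner_basis n I F \<and> (\<forall>f\<in>F. quasi_homogeneous n m f)" and t: "t \<ge> -2"
  have "quasi_homogeneous_basis n I F"
    using assms G groebner_basis_lead_dvd[OF assms(1,2)]
    by unfold_locales (auto simp: groebner_basis_def)
  then show "stable_generating_set (H2_norm t) I F"
    using t by (rule quasi_homogeneous_basis.stable_generating_set_H2)
qed

end
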